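(* Let $X^{\mathrm{tar}}$ and $X^{\mathrm{map}}$ be random vectors in $\mathbb{R}^D$ with finite second moments, with means $\mu^{\mathrm{tar}}=\mathbb{E}[X^{\mathrm{tar}}]$ and $\mu^{\mathrm{map}}=\mathbb{E}[X^{\mathrm{map}}]$, and let $\eta\in\mathbb{R}$ be a scale. Let $\hat V^{\mathrm{map}}\in\mathbb{R}^{D\times r_1}$ be a matrix of top-$r_1$ principal components of $\operatorname{Cov}(X^{\mathrm{map}})$, let $\hat V^{\mathrm{tar}}\in\mathbb{R}^{D\times r_2}$ be a matrix of top-$r_2$ principal components of $\operatorname{Cov}(X^{\mathrm{tar}})$, and put $P^{\mathrm{map}}=\hat V^{\mathrm{map}}(\hat V^{\mathrm{map}})^T$. Define $$Z^{\mathrm{tar}}=\hat V^{\mathrm{tar}}(\hat V^{\mathrm{tar}})^T\left(X^{\mathrm{tar}}-\mathbb{E}[X^{\mathrm{tar}}]\right)+\mathbb{E}[X^{\mathrm{tar}}].$$ Consider the problem of minimizing, over $P\in\mathbb{R}^{D\times D}$ and $b\in\mathbb{R}^D$, $$\mathbb{E}\left[\left\|PX^{\mathrm{tar}}+b-\eta\left(P^{\mathrm{map}}(X^{\mathrm{tar}}-\mu^{\mathrm{tar}})+\mu^{\mathrm{map}}\right)\right\|_2^2\right]\quad\text{subject to}\quad \operatorname{Cov}(PX^{\mathrm{tar}},Z^{\mathrm{tar}})=\mathbf{0}.$$ Then the minimum is attained at $$P^*=\eta\,\hat V^{\mathrm{map}}(\hat V^{\mathrm{map}})^T\left(I-\hat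 V^{\mathrm{tar}}(\hat V^{\mathrm{tar}})^T\right),\qquad b^*=\eta\mu^{\mathrm{map}}-P^*\mu^{\mathrm{tar}}.$$
   Context: $\operatorname{Cov}(X)=\mathbb{E}[(X-\mathbb{E}X)(X-\mathbb{E}X)^T]$ is the covariance matrix and $\operatorname{Cov}(X,Z)=\mathbb{E}[(X-\mathbb{E}X)(Z-\mathbb{E}Z)^T]$ is the cross-covariance matrix. A matrix of top-$r$ principal components of a $D\times D$ covariance matrix $\Sigma$ (where $1\le r\le D$) means the following: take a singular value decomposition $\Sigma=VSV^T$ with $V$ orthogonal and $S$ diagonal with nonnegative entries; the matrix consists of the $r$ columns of $V$ corresponding to the $r$ largest diagonal entries of $S$ (so its columns are orthonormal eigenvectors of $\Sigma$). $I$ is the $D\times D$ identity matrix. *)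

theory Defs
  imports "HOL-Probability.Probability"
begin

text \<open>
  Random vectors are Borel functions into \<^typ>\<open>real^'n\<close>, and expectations are Bochner
  integrals.  The Bochner integral of a non-integrable function is 0; on a probability space, square integrability
  of both arguments rules this out in the definition of \<open>cross_cov\<close> below.
\<close>

definition square_integrable_vec :: "'a measure \<Rightarrow> ('a \<Rightarrow> real^'n) \<Rightarrow> bool" where
  "square_integrable_vec M X \<longleftrightarrow>
     X \<in> borel_measurable M \<and> integrable M (\<lambda>\<omega>. (norm (X \<omega>))\<^sup>2)"

definition cross_cov :: "'a measure \<Rightarrow> ('a \<Rightarrow> real^'n) \<Rightarrow> ('a \<Rightarrow> real^'m) \<Rightarrow> real^'m^'n" where
  "cross_cov M X Z =
     integral\<^sup>L M (\<lambda>\<omega>. (columnvector (X \<omega> - integral\<^sup>L M X) :: real^1^'n)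
                      ** (rowvector (Z \<omega> - integral\<^sup>L M Z) :: real^'m^1))"

definition cov :: "'a measure \<Rightarrow> ('a \<Rightarrow> real^'n) \<Rightarrow> real^'n^'n" where
  "cov M X = cross_cov M X X"

text \<open>
  A matrix of top \<open>CARD('r)\<close> principal components of \<open>\<Sigma>\<close>: the injection \<open>f\<close> selects the
  columns of \<open>V\<close>.  Ties between diagonal entries of \<open>S\<close> may be broken arbitrarily, and the
  selected columns may be listed in any order.  Injectivity forces
  \<open>CARD('r) \<le> CARD('n)\<close>.
\<close>

definition top_principal_components :: "real^'n^'n \<Rightarrow> real^'r^'n \<Rightarrow> bool" where
  "top_principal_components \<Sigma> W \<longleftrightarrow>
     (\<exists>(V :: real^'n^'n) (S :: real^'n^'n) (f :: 'r \<Rightarrow> 'n).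
        orthogonal_matrix V \<and>
        (\<forall>i j. i \<noteq> j \<longrightarrow> S$i$j = 0) \<and> (\<forall>i. 0 \<le> S$i$i) \<and>
        \<Sigma> = V ** S ** transpose V \<and>
        inj f \<and> (\<forall>k. column k W = column (f k) V) \<and>
        (\<forall>k. \<forall>i. i \<notin> range f \<longrightarrow> S$i$i \<le> S$(f k)$(f k)))"

end

theory Submission
  imports Defs
begin

text \<open>
  Write \<open>Y\<close> for the centred target, \<open>\<Sigma>\<close> for its covariance and \<open>Q = Vtar ** transpose Vtar\<close>. The
  constraint reads \<open>P ** \<Sigma> ** Q = 0\<close>, and \<open>Q\<close> is an idempotent commuting with \<open>\<Sigma>\<close>, so \<open>Pstar\<close> is
  feasible. For feasible \<open>(P, b)\<close> the residual is the sum of the optimal residual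
  \<open>- \<eta> Pmap Q Y\<close> and of \<open>(P - Pstar) Y + c\<close> with \<open>c\<close> constant. The constraint makes
  these two orthogonal in \<open>L\<^sup>2\<close>, so the objective exceeds its value at \<open>(Pstar, bstar)\<close> by the
  second moment of \<open>(P - Pstar) Y + c\<close>.
\<close>

section \<open>Projections onto principal components\<close>

lemma diagonal_matrix_mult_nth:
  fixes A B :: "'a::semiring_1^'n^'n"
  assumes "\<And>i j. i \<noteq> j \<Longrightarrow> A $ i $ j = 0"
  shows "(A ** B) $ i $ j = A $ i $ i * B $ i $ j"
proof -
  have "(A ** B) $ i $ j = (\<Sum>k\<in>UNIV. A $ i $ k * B $ k $ j)"
    by (simp add: matrix_matrix_mult_def)
  also have "\<dots> = (\<Sum>k\<in>{i}. A $ i $ k * B $ k $ j)"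
    by (rule sum.mono_neutral_right) (use assms in auto)
  finally show ?thesis by simp
qed

text \<open>In the eigenbasis given by \<open>V\<close> both matrices are diagonal:
  \<open>\<Sigma>\<close> becomes \<open>S\<close>, and \<open>Q\<close> becomes the 0/1 matrix
  marking the selected columns. Diagonal matrices commute, and 0/1 entries are idempotent.\<close>

lemma top_principal_components_projection:
  fixes \<Sigma> :: "real^'n^'n" and W :: "real^'r^'n"
  assumes "top_principal_components \<Sigma> W"
  defines "Q \<equiv> W ** transpose W"
  shows "Q ** Q = Q" "Q ** \<Sigma> = \<Sigma> ** Q"
proof -
  obtain V S :: "real^'n^'n" and f :: "'r \<Rightarrow> 'n"
    where V: "orthogonal_matrix V" and S: "\<And>i j. i \<noteq> j \<Longrightarrow> S $ i $ j = 0"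
      and \<Sigma>: "\<Sigma> = V ** S ** transpose V" and "inj f"
      and W: "\<And>k. column k W = column (f k) V"
    using assms(1) unfolding top_principal_components_def by blast
  define E :: "real^'n^'n" where "E = (\<chi> i j. if i = j \<and> i \<in> range f then 1 else 0)"
  have E: "\<And>i j. i \<noteq> j \<Longrightarrow> E $ i $ j = 0"
    by (simp add: E_def)
  have EE: "E ** E = E"
    by (simp add: vec_eq_iff diagonal_matrix_mult_nth[OF E]) (simp add: E_def)
  have ES: "E ** S = S ** E"
    by (simp add: vec_eq_iff diagonal_matrix_mult_nth[OF E] diagonal_matrix_mult_nth[OF S])
       (auto simp: E_def S)
  have VV: "transpose V ** V = mat 1"
    using V by (simp add: orthogonal_matrix)
  have Wnth: "W $ i $ k = V $ i $ f k" for i k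
    using W[of k] by (simp add: column_def vec_eq_iff)
  have Q: "Q = V ** E ** transpose V"
  proof -
    have "Q $ i $ j = (V ** E ** transpose V) $ i $ j" for i j
    proof -
      have "(E ** transpose V) $ k $ j = (if k \<in> range f then V $ j $ k else 0)" for k
        by (simp add: diagonal_matrix_mult_nth[OF E]) (simp add: E_def transpose_def)
      then have "(V ** (E ** transpose V)) $ i $ j
          = (\<Sum>k\<in>UNIV. if k \<in> range f then V $ i $ k * V $ j $ k else 0)"
        by (subst matrix_matrix_mult_def) (auto intro!: sum.cong)
      also have "\<dots> = (\<Sum>k\<in>range f. V $ i $ k * V $ j $ k)"
        by (subst sum.inter_restrict[symmetric]) auto
      \<comment> \<open>Since \<open>f\<close> is injective, each selected column is counted exactly
        once.\<close>
      also have "\<dots> = (\<Sum>k\<in>UNIV. V $ i $ f k * V $ j $ f k)"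
        by (simp add: sum.reindex \<open>inj f\<close>)
      also have "\<dots> = Q $ i $ j"
        by (simp add: Q_def matrix_matrix_mult_def transpose_def Wnth)
      finally show ?thesis by (simp add: matrix_mul_assoc)
    qed
    then show ?thesis by (simp add: vec_eq_iff)
  qed
  \<comment> \<open>Conjugation by \<open>V\<close> is multiplicative because
    \<open>transpose V ** V\<close> cancels in the middle; this transfers \<open>EE\<close> and
    \<open>ES\<close> to \<open>Q\<close> and \<open>\<Sigma>\<close>.\<close>
  have conj_mult: "(V ** A ** transpose V) ** (V ** B ** transpose V) = V ** (A ** B) ** transpose V"
    for A B
  proof -
    have "(V ** A ** transpose V) ** (V ** B ** transpose V)
        = V ** A ** (transpose V ** V) ** B ** transpose V"
      by (simp only: matrix_mul_assoc)
    then show ?thesis by (simp only: VV matrix_mul_rid matrix_mul_assoc)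
  qed
  show "Q ** Q = Q" "Q ** \<Sigma> = \<Sigma> ** Q"
    unfolding Q \<Sigma> conj_mult EE ES by (rule refl)+
qed

section \<open>Second moments\<close>

text \<open>Bounded linear maps commute with Bochner integrals of integrable functions. This fact,
  its mirror image and the one for \<open>trace\<close> let constant matrices and traces pass
  through the covariance integral.\<close>

lemma bounded_linear_matrix_mult_left: "bounded_linear (\<lambda>A :: real^'n^'m. (B :: real^'m^'k) ** A)"
  by (simp add: linear_conv_bounded_linear[symmetric] linear_iff matrix_add_ldistrib
      matrix_scalar_ac scalar_matrix_assoc)

lemma bounded_linear_matrix_mult_right: "bounded_linear (\<lambda>A :: real^'n^'m. A ** (B :: real^'k^'n))"
  by (simp add: linear_conv_bounded_linear[symmetric] linear_iff scalar_matrix_assoc)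
     (simp add: vec_eq_iff matrix_matrix_mult_def sum.distrib distrib_right)

lemmas matrix_diff_rdistrib = linear_diff[OF bounded_linear.linear[OF bounded_linear_matrix_mult_right]]

lemma bounded_linear_trace: "bounded_linear (trace :: real^'n^'n \<Rightarrow> real)"
  by (simp add: linear_conv_bounded_linear[symmetric] linear_iff trace_add)
     (simp add: trace_def sum_distrib_left)

lemma columnvector_mult_rowvector_nth:
  "((columnvector x :: real^1^'n) ** (rowvector y :: real^'m^1)) $ i $ j = x $ i * y $ j"
  by (simp add: matrix_matrix_mult_def columnvector_def rowvector_def)

lemma columnvector_mult_rowvector_matrix_vector:
  "(columnvector (A *v x) :: real^1^'k) ** (rowvector (B *v y) :: real^'l^1)
    = A ** ((columnvector x :: real^1^'n) ** (rowvector y :: real^'m^1)) ** transpose B"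
proof -
  have "columnvector (A *v x) = A ** (columnvector x :: real^1^'n)"
    by (simp add: vec_eq_iff columnvector_def matrix_matrix_mult_def matrix_vector_mult_def)
  moreover have "rowvector (B *v y) = (rowvector y :: real^'m^1) ** transpose B"
    by (simp add: vec_eq_iff rowvector_def matrix_matrix_mult_def matrix_vector_mult_def
        transpose_def mult.commute)
  ultimately show ?thesis by (simp add: matrix_mul_assoc)
qed

lemma bounded_bilinear_columnvector_mult_rowvector:
  "bounded_bilinear (\<lambda>(x :: real^'n) (y :: real^'m). (columnvector x :: real^1^'n) ** (rowvector y :: real^'m^1))"
  unfolding bilinear_conv_bounded_bilinear[symmetric] bilinear_def linear_iff
  by (simp add: vec_eq_iff columnvector_mult_rowvector_nth algebra_simps)

lemma inner_eq_trace_columnvector_mult_rowvector: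
  "(x :: real^'n) \<bullet> y = trace ((columnvector x :: real^1^'n) ** (rowvector y :: real^'n^1))"
  by (simp add: trace_def columnvector_mult_rowvector_nth inner_vec_def)

text \<open>Domination by \<open>K\<close> times the sum of the two squared norms. Stated for
  general \<open>h\<close>, it serves outer products, inner products and scalar multiplication
  alike.\<close>

lemma square_integrable_vec_bounded_bilinear:
  fixes h :: "real^'n \<Rightarrow> real^'m \<Rightarrow> 'c::euclidean_space"
  assumes "bounded_bilinear h" "square_integrable_vec M X" "square_integrable_vec M Y"
  shows "integrable M (\<lambda>\<omega>. h (X \<omega>) (Y \<omega>))"
proof -
  interpret bounded_bilinear h by fact
  obtain K where "0 \<le> K" and K: "\<And>x y. norm (h x y) \<le> norm x * norm y * K"
    using nonneg_bounded by blast
  have [measurable]: "X \<in> borel_measurable M" "Y \<in> borel_measurable M"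
    and int: "integrable M (\<lambda>\<omega>. (norm (X \<omega>))\<^sup>2)" "integrable M (\<lambda>\<omega>. (norm (Y \<omega>))\<^sup>2)"
    using assms(2,3) by (auto simp: square_integrable_vec_def)
  have "continuous_on UNIV (\<lambda>p. h (fst p) (snd p))"
    by (intro continuous_intros continuous_on)
  then have "(\<lambda>p. h (fst p) (snd p)) \<in> borel_measurable borel"
    by (rule borel_measurable_continuous_onI)
  then have meas: "(\<lambda>\<omega>. h (X \<omega>) (Y \<omega>)) \<in> borel_measurable M"
    using measurable_compose[of "\<lambda>\<omega>. (X \<omega>, Y \<omega>)" M borel "\<lambda>p. h (fst p) (snd p)" borel] by simp
  have "norm (h (X \<omega>) (Y \<omega>)) \<le> K * ((norm (X \<omega>))\<^sup>2 + (norm (Y \<omega>))\<^sup>2)" for \<omega>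
  proof -
    \<comment> \<open>The product is nonnegative, hence at most twice itself, which is bounded by
      the sum of squares.\<close>
    have "norm (X \<omega>) * norm (Y \<omega>) \<le> (norm (X \<omega>))\<^sup>2 + (norm (Y \<omega>))\<^sup>2"
      using sum_squares_bound[of "norm (X \<omega>)" "norm (Y \<omega>)"]
        mult_nonneg_nonneg[OF norm_ge_zero norm_ge_zero, of "X \<omega>" "Y \<omega>"] by linarith
    from mult_left_mono[OF this \<open>0 \<le> K\<close>] K[of "X \<omega>" "Y \<omega>"] show ?thesis
      by (simp add: mult.commute)
  qed
  then show ?thesis
    by (intro Bochner_Integration.integrable_bound[OF _ meas,
          of "\<lambda>\<omega>. K * ((norm (X \<omega>))\<^sup>2 + (norm (Y \<omega>))\<^sup>2)"] AE_I2
        integrable_mult_right Bochner_Integration.integrable_add int)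
       (metis abs_ge_self order_trans real_norm_def)
qed

lemma square_integrable_vec_matrix_mult:
  fixes A :: "real^'n^'m"
  assumes "square_integrable_vec M X"
  shows "square_integrable_vec M (\<lambda>\<omega>. A *v X \<omega>)"
proof -
  \<comment> \<open>The squared norm of \<open>A *v X \<omega>\<close> is this form on the
    diagonal.\<close>
  have "bounded_bilinear (\<lambda>x y. (A *v x) \<bullet> (A *v y))"
    by (rule bounded_bilinear.comp[OF bounded_bilinear_inner
          matrix_vector_mul_bounded_linear matrix_vector_mul_bounded_linear])
  then have "integrable M (\<lambda>\<omega>. (norm (A *v X \<omega>))\<^sup>2)"
    using square_integrable_vec_bounded_bilinear[OF _ assms assms] by (simp add: power2_norm_eq_inner)
  moreover have "(\<lambda>\<omega>. A *v X \<omega>) \<in> borel_measurable M"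
    using assms borel_measurable_continuous_onI[of "(*v) A"]
    by (auto simp: square_integrable_vec_def intro!: measurable_compose[of X M borel]
        linear_continuous_on matrix_vector_mul_bounded_linear)
  ultimately show ?thesis by (simp add: square_integrable_vec_def)
qed

lemma square_integrable_vec_add:
  assumes "square_integrable_vec M X" "square_integrable_vec M Y"
  shows "square_integrable_vec M (\<lambda>\<omega>. X \<omega> + Y \<omega>)"
proof -
  have "integrable M (\<lambda>\<omega>. X \<omega> \<bullet> X \<omega> + 2 * (X \<omega> \<bullet> Y \<omega>) + Y \<omega> \<bullet> Y \<omega>)"
    by (intro Bochner_Integration.integrable_add integrable_mult_right
        square_integrable_vec_bounded_bilinear bounded_bilinear_inner assms)
  moreover have "(\<lambda>\<omega>. X \<omega> \<bullet> X \<omega> + 2 * (X \<omega> \<bullet> Y \<omega>) + Y \<omega> \<bullet> Y \<omega>) = (\<lambda>\<omega>. (norm (X \<omega> + Y \<omega>))\<^sup>2)"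
    by (simp add: power2_norm_eq_inner inner_add inner_commute algebra_simps)
  ultimately show ?thesis
    using assms by (auto simp: square_integrable_vec_def)
qed

context prob_space
begin

lemma square_integrable_vec_const: "square_integrable_vec M (\<lambda>_. c)"
  by (simp add: square_integrable_vec_def)

lemma square_integrable_vec_integrable:
  assumes "square_integrable_vec M X"
  shows "integrable M X"
proof -
  \<comment> \<open>Pairing \<open>X\<close> with the constant 1 in \<open>real^1\<close> returns
    \<open>X\<close>; the constant is square integrable because the total mass is finite.\<close>
  have "bounded_bilinear (\<lambda>(x :: real^'b) (y :: real^1). y $ 1 *\<^sub>R x)"
    unfolding bilinear_conv_bounded_bilinear[symmetric] bilinear_def linear_iff
    by (simp add: algebra_simps)
  from square_integrable_vec_bounded_bilinear[OF this assms square_integrable_vec_const[of "vec 1"]]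
  show ?thesis by simp
qed

lemma square_integrable_vec_centered:
  "square_integrable_vec M X \<Longrightarrow> square_integrable_vec M (\<lambda>\<omega>. X \<omega> - expectation X)"
  using square_integrable_vec_add[OF _ square_integrable_vec_const[of "- expectation X"]] by simp

lemma expectation_matrix_mult_add:
  fixes X :: "'a \<Rightarrow> real^'n" and A :: "real^'n^'k"
  assumes "integrable M X"
  shows "expectation (\<lambda>\<omega>. A *v X \<omega> + a) = A *v expectation X + a"
  using integrable_bounded_linear[OF matrix_vector_mul_bounded_linear assms, of A]
    integral_bounded_linear[OF matrix_vector_mul_bounded_linear assms, of A]
  by (simp add: prob_space)

text \<open>Centring cancels the shifts \<open>a\<close> and \<open>b\<close>. The outer product of
  the centred vector with itself is integrable, so the constant matrices can be moved outside the
  integral.\<close>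

lemma cross_cov_affine:
  fixes A :: "real^'n^'k" and B :: "real^'n^'l"
  assumes X: "square_integrable_vec M X"
  shows "cross_cov M (\<lambda>\<omega>. A *v X \<omega> + a) (\<lambda>\<omega>. B *v X \<omega> + b) = A ** cov M X ** transpose B"
proof -
  let ?G = "\<lambda>\<omega>. (columnvector (X \<omega> - expectation X) :: real^1^'n)
    ** (rowvector (X \<omega> - expectation X) :: real^'n^1)"
  have int: "integrable M ?G"
    by (intro square_integrable_vec_bounded_bilinear bounded_bilinear_columnvector_mult_rowvector
        square_integrable_vec_centered X)
  have lin: "bounded_linear (\<lambda>C. A ** C ** transpose B)"
    by (intro bounded_linear_compose[OF bounded_linear_matrix_mult_right]
        bounded_linear_matrix_mult_left)
  show ?thesis
    using integral_bounded_linear[OF lin int]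
    by (simp add: cov_def cross_cov_def expectation_matrix_mult_add
        square_integrable_vec_integrable[OF X] matrix_vector_mult_diff_distrib[symmetric]
        columnvector_mult_rowvector_matrix_vector)
qed

text \<open>An inner product is the trace of an outer product, and the trace commutes with
  expectation. This translates matrix identities about the covariance into orthogonality in
  L2.\<close>

lemma expectation_inner_centered:
  fixes A B :: "real^'n^'k"
  assumes X: "square_integrable_vec M X"
  shows "expectation (\<lambda>\<omega>. (A *v (X \<omega> - expectation X)) \<bullet> (B *v (X \<omega> - expectation X)))
    = trace (A ** cov M X ** transpose B)"
proof -
  let ?G = "\<lambda>\<omega>. (columnvector (A *v X \<omega> - A *v expectation X) :: real^1^'k)
    ** (rowvector (B *v X \<omega> - B *v expectation X) :: real^'k^1)"
  have sq: "square_integrable_vec M (\<lambda>\<omega>. C *v X \<omega> - C *v expectation X)" for C :: "real^'n^'k"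
    using square_integrable_vec_matrix_mult[OF square_integrable_vec_centered[OF X], of C]
    by (simp add: matrix_vector_mult_diff_distrib)
  have int: "integrable M ?G"
    by (intro square_integrable_vec_bounded_bilinear
        bounded_bilinear_columnvector_mult_rowvector sq)
  have EX: "expectation (\<lambda>\<omega>. C *v X \<omega>) = C *v expectation X" for C :: "real^'n^'k"
    using expectation_matrix_mult_add[OF square_integrable_vec_integrable[OF X], of C 0] by simp
  have "expectation ?G = A ** cov M X ** transpose B"
    using cross_cov_affine[OF X, of A 0 B 0] by (simp add: cross_cov_def EX)
  with integral_bounded_linear[OF bounded_linear_trace int] show ?thesis
    by (simp add: inner_eq_trace_columnvector_mult_rowvector matrix_vector_mult_diff_distrib)
qed

text \<open>Pythagoras in L2: \<open>orth\<close> makes \<open>A *v Y \<omega>\<close> orthogonal to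
  \<open>B *v Y \<omega>\<close>, and the constant \<open>c\<close> is orthogonal to it because
  \<open>Y\<close> has mean zero. Only a nonnegative square is added.\<close>

lemma second_moment_le_if_orthogonal:
  fixes A B :: "real^'n^'k"
  assumes X: "square_integrable_vec M X" and orth: "A ** cov M X ** transpose B = 0"
  defines "Y \<equiv> \<lambda>\<omega>. X \<omega> - expectation X"
  shows "expectation (\<lambda>\<omega>. (norm (B *v Y \<omega>))\<^sup>2)
    \<le> expectation (\<lambda>\<omega>. (norm ((A *v Y \<omega> + c) + B *v Y \<omega>))\<^sup>2)"
proof -
  let ?U = "\<lambda>\<omega>. A *v Y \<omega> + c" and ?B = "\<lambda>\<omega>. B *v Y \<omega>"
  have Y: "square_integrable_vec M Y"
    unfolding Y_def by (rule square_integrable_vec_centered[OF X])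
  have EY: "expectation Y = 0"
    by (simp add: Y_def square_integrable_vec_integrable[OF X] prob_space)
  note sq = square_integrable_vec_matrix_mult[OF Y] square_integrable_vec_const
    square_integrable_vec_add
  have int: "integrable M (\<lambda>\<omega>. ?U \<omega> \<bullet> ?U \<omega>)" "integrable M (\<lambda>\<omega>. ?U \<omega> \<bullet> ?B \<omega>)"
    "integrable M (\<lambda>\<omega>. ?B \<omega> \<bullet> ?B \<omega>)" "integrable M (\<lambda>\<omega>. (A *v Y \<omega>) \<bullet> ?B \<omega>)"
    by (intro square_integrable_vec_bounded_bilinear bounded_bilinear_inner sq)+
  have intB: "integrable M ?B"
    by (intro square_integrable_vec_integrable sq)
  have "expectation ?B = 0"
    using expectation_matrix_mult_add[OF square_integrable_vec_integrable[OF Y], of B 0] EY by simp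
  then have cross: "expectation (\<lambda>\<omega>. ?U \<omega> \<bullet> ?B \<omega>) = 0"
    using expectation_inner_centered[OF X, of A B] int(4) intB
    by (simp add: inner_add_left orth trace_def Y_def)
  have "(\<lambda>\<omega>. (norm (?U \<omega> + ?B \<omega>))\<^sup>2)
      = (\<lambda>\<omega>. ?U \<omega> \<bullet> ?U \<omega> + (2 * (?U \<omega> \<bullet> ?B \<omega>) + ?B \<omega> \<bullet> ?B \<omega>))"
    unfolding power2_norm_eq_inner
    \<comment> \<open>The instantiated rules split only the outer sum and keep \<open>?U\<close>
      whole.\<close>
    by (rule ext) (simp only: inner_add_left[of "?U _"] inner_add_right[of _ "?U _"]
        inner_commute[of "?B _" "?U _"])
  then have "expectation (\<lambda>\<omega>. (norm (?U \<omega> + ?B \<omega>))\<^sup>2)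
      = expectation (\<lambda>\<omega>. ?U \<omega> \<bullet> ?U \<omega>) + expectation (\<lambda>\<omega>. (norm (?B \<omega>))\<^sup>2)"
    using int(1-3) cross by (simp add: power2_norm_eq_inner)
  moreover have "0 \<le> expectation (\<lambda>\<omega>. ?U \<omega> \<bullet> ?U \<omega>)"
    by (intro integral_nonneg_AE) simp
  ultimately show ?thesis by linarith
qed

end

section \<open>The constrained least squares problem\<close>

theorem proposition1:
  fixes M :: "'a measure" and N :: "'b measure"
    and Xtar :: "'a \<Rightarrow> real^'d" and Xmap :: "'b \<Rightarrow> real^'d"
    and \<mu>tar \<mu>map :: "real^'d" and \<eta> :: real
    and Vmap :: "real^'r1^'d" and Vtar :: "real^'r2^'d"
    and Pmap Pstar :: "real^'d^'d" and bstar :: "real^'d"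
    and Ztar :: "'a \<Rightarrow> real^'d"
  assumes "prob_space M" and "prob_space N"
    and "square_integrable_vec M Xtar" and "square_integrable_vec N Xmap"
    and "\<mu>tar = integral\<^sup>L M Xtar" and "\<mu>map = integral\<^sup>L N Xmap"
    and "top_principal_components (cov N Xmap) Vmap"
    and "top_principal_components (cov M Xtar) Vtar"
    and "Pmap = Vmap ** transpose Vmap"
    and "Ztar = (\<lambda>\<omega>. (Vtar ** transpose Vtar) *v (Xtar \<omega> - integral\<^sup>L M Xtar) + integral\<^sup>L M Xtar)"
    and "Pstar = \<eta> *\<^sub>R (Vmap ** transpose Vmap ** (mat 1 - Vtar ** transpose Vtar))"
    and "bstar = \<eta> *\<^sub>R \<mu>map - Pstar *v \<mu>tar"
  shows "is_arg_min
           (\<lambda>(P :: real^'d^'d, b :: real^'d).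
              integral\<^sup>L M (\<lambda>\<omega>.
                (norm (P *v Xtar \<omega> + b - \<eta> *\<^sub>R (Pmap *v (Xtar \<omega> - \<mu>tar) + \<mu>map)))\<^sup>2))
           (\<lambda>(P, b). cross_cov M (\<lambda>\<omega>. P *v Xtar \<omega>) Ztar = 0)
           (Pstar, bstar)"
proof -
  interpret prob_space M by fact
  note X = assms(3) and mu = assms(5)
  define \<Sigma> where "\<Sigma> = cov M Xtar"
  define Q where "Q = Vtar ** transpose Vtar"
  define Y where "Y = (\<lambda>\<omega>. Xtar \<omega> - \<mu>tar)"
  have QQ: "Q ** Q = Q" and Q\<Sigma>: "Q ** \<Sigma> = \<Sigma> ** Q"
    using top_principal_components_projection[OF assms(8)] by (simp_all add: Q_def \<Sigma>_def)
  have QT: "transpose Q = Q"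
    by (simp add: Q_def matrix_transpose_mul)
  have Pstar: "Pstar = \<eta> *\<^sub>R (Pmap ** (mat 1 - Q))"
    by (simp add: assms(9,11) Q_def)
  \<comment> \<open>Written as an affine image of \<open>Xtar\<close>, so that
    \<open>cross_cov_affine\<close> evaluates the constraint.\<close>
  have Ztar: "Ztar = (\<lambda>\<omega>. Q *v Xtar \<omega> + (\<mu>tar - Q *v \<mu>tar))"
    by (simp add: assms(10) Q_def mu matrix_vector_mult_diff_distrib fun_eq_iff
        add_diff_eq diff_add_eq)
  have cc: "cross_cov M (\<lambda>\<omega>. P *v Xtar \<omega>) Ztar = P ** \<Sigma> ** Q" for P :: "real^'d^'d"
    using cross_cov_affine[OF X, of P 0 Q "\<mu>tar - Q *v \<mu>tar"]
    by (simp add: Ztar \<Sigma>_def QT)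
  \<comment> \<open>Commuting \<open>Q\<close> past \<open>\<Sigma>\<close> turns the subtracted
    term into \<open>\<Sigma> ** Q ** Q\<close>, which equals \<open>\<Sigma> ** Q\<close>.\<close>
  have "(mat 1 - Q) ** \<Sigma> ** Q = 0"
    by (simp add: matrix_diff_rdistrib Q\<Sigma> matrix_mul_assoc[symmetric] QQ)
  then have feasible: "Pstar ** \<Sigma> ** Q = 0"
    by (simp add: Pstar scalar_matrix_assoc[symmetric] matrix_mul_assoc[symmetric])
  \<comment> \<open>What remains of \<open>Pstar - \<eta> *\<^sub>R Pmap\<close>: the part of the
    target map that feasibility forces \<open>Pstar\<close> to drop.\<close>
  define R where "R = (- \<eta>) *\<^sub>R (Pmap ** Q)"
  \<comment> \<open>At \<open>(Pstar, bstar)\<close> both the matrix \<open>P - Pstar\<close> and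
    the constant vanish, leaving only \<open>R *v Y \<omega>\<close>.\<close>
  have residual: "P *v Xtar \<omega> + b - \<eta> *\<^sub>R (Pmap *v (Xtar \<omega> - \<mu>tar) + \<mu>map)
      = ((P - Pstar) *v Y \<omega> + (P *v \<mu>tar + b - \<eta> *\<^sub>R \<mu>map)) + R *v Y \<omega>" for P b \<omega>
  proof -
    have "Pstar *v y + \<eta> *\<^sub>R (Pmap *v (Q *v y)) = \<eta> *\<^sub>R (Pmap *v y)" for y
      by (simp add: Pstar scaleR_matrix_vector_assoc[symmetric] matrix_vector_mul_assoc[symmetric]
          algebra_simps)
    moreover have "R *v y = (- \<eta>) *\<^sub>R (Pmap *v (Q *v y))" for y
      by (simp only: R_def scaleR_matrix_vector_assoc[symmetric] matrix_vector_mul_assoc[symmetric])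
    ultimately have "Pstar *v y - R *v y = \<eta> *\<^sub>R (Pmap *v y)" for y
      by simp
    then have "\<eta> *\<^sub>R (Pmap *v (Xtar \<omega> - \<mu>tar) + \<mu>map) = Pstar *v Y \<omega> - R *v Y \<omega> + \<eta> *\<^sub>R \<mu>map"
      by (simp only: Y_def scaleR_add_right)
    moreover have "P *v Xtar \<omega> = P *v Y \<omega> + P *v \<mu>tar"
      by (simp add: Y_def matrix_vector_right_distrib[symmetric])
    ultimately show ?thesis
      by (simp only: matrix_vector_mult_diff_rdistrib) (simp add: algebra_simps)
  qed
  have "expectation (\<lambda>\<omega>. (norm (R *v Y \<omega>))\<^sup>2)
      \<le> expectation (\<lambda>\<omega>. (norm (((P - Pstar) *v Y \<omega> + c) + R *v Y \<omega>))\<^sup>2)"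
    if "P ** \<Sigma> ** Q = 0" for P :: "real^'d^'d" and c
  proof -
    \<comment> \<open>The leading factor \<open>Q\<close> lets the linear constraint, satisfied by
      \<open>P\<close> and \<open>Pstar\<close> and hence by their difference, give the
      orthogonality hypothesis.\<close>
    have "transpose R = Q ** ((- \<eta>) *\<^sub>R transpose Pmap)"
      by (simp only: R_def transpose_scalar matrix_transpose_mul QT matrix_scalar_ac scalar_matrix_assoc)
    moreover have "(P - Pstar) ** \<Sigma> ** Q = 0"
      by (simp add: matrix_diff_rdistrib that feasible)
    ultimately have "(P - Pstar) ** cov M Xtar ** transpose R = 0"
      by (simp add: \<Sigma>_def[symmetric] matrix_mul_assoc)
    from second_moment_le_if_orthogonal[OF X this] show ?thesis
      by (simp add: Y_def mu)
  qed
  \<comment> \<open>The left side of the inequality is the objective at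
    \<open>(Pstar, bstar)\<close>; the right side, with \<open>c\<close> the constant from
    \<open>residual\<close>, is the objective at a feasible competitor.\<close>
  then show ?thesis
    by (auto simp: is_arg_min_def cc feasible residual assms(12) not_less)
qed

end
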